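(* Let $I=[a,b]$ with $-\infty<a<b<\infty$, and let $\{\omega_{s,t}\}_{(s,t)\in I_+^2}$ be an evolution family on $I$. Then the following are equivalent: (i) the family $\{\omega_{s,t}\}_{(s,t)\in I_+^2}$ is jointly continuous; (v) the family $\{\omega_{s,t}\}_{(s,t)\in I_+^2}$ is hyperbolically bounded and continuous with respect to the left parameter; (vi) the family $\{\omega_{s,t}\}_{(s,t)\in I_+^2}$ is hyperbolically bounded, $\lim_{s\le c\le t,\ t-s\searrow 0}\omega_{s,t}(0)=0$ for all $c\in[a,b]$, and $\omega_{s,b}'(0)$ is a continuous function of $s\in[a,b]$ with $\omega_{s,b}'(0)\neq 0$ for all $s\in[a,b]$.
   Context: $\mathbb{D}=\{z\in\mathbb{C}:|z|<1\}$. $\mathcal{A}$ is the space of all analytic functions $f:\mathbb{D}\to\mathbb{C}$ with the topology of locally uniform convergence on $\mathbb{D}$, and $\mathfrak{B}=\{f\in\mathcal{A}: f(\mathbb{D})\subset\mathbb{D}\}$. For an interval $I$, $I_+^2=\{(s,t): s,t\in I,\ s\le t\}$. A prime denotes the derivative with respect to $z$. Evolution family: a family $\{\omega_{s,t}\}_{(s,t)\in I_+^2}$ in $\mathfrak{B}$ is an evolution family (on $I$) if (EF1) $\omega_{s,t}$ is non-constant for all $(s,t)\in I_+^2$; (EF2) $\omega_{t,t}=\mathrm{id}_{\mathbb{D}}$ for all $t\in I$; (EF3) $\omega_{u,t}\circ\omega_{s,u}=\omega_{s,t}$ for all $s,u,t\in I$ with $s\le u\le t$. Jointly continuous: the mapping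 $I_+^2\ni(s,t)\mapsto\omega_{s,t}\in\mathcal{A}$ is continuous. Continuous with respect to the left parameter (for $I=[a,b]$): the mapping $I\ni s\mapsto\omega_{s,b}\in\mathcal{A}$ is continuous. Hyperbolically bounded: $\sup_{(s,t)\in I_+^2}|\omega_{s,t}(0)|<1$. For fixed $c\in[a,b]$, the limit $\lim_{s\le c\le t,\ t-s\searrow 0}$ is taken over $s,t\in[a,b]$ with $s\le c\le t$ as $t-s$ decreases to $0$. *)

theory Defs
  imports "HOL-Complex_Analysis.Complex_Analysis"
begin

abbreviation unit_disc :: "complex set"  (\<open>\<D>\<close>)
  where "\<D> \<equiv> ball 0 1"

text \<open>
  Analytic functions on the disc are represented by total functions; their values outside
  the disc are irrelevant.  Hence equality of two such functions is always equality on the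
  disc, and the topology below does not separate functions that agree on the disc.
\<close>

definition analytic_functions :: "(complex \<Rightarrow> complex) set"  (\<open>\<A>\<close>)
  where "\<A> = {f. f holomorphic_on \<D>}"

definition analytic_self_maps :: "(complex \<Rightarrow> complex) set"  (\<open>\<BB>\<close>)
  where "\<BB> = {f \<in> \<A>. f ` \<D> \<subseteq> \<D>}"

text \<open>
  On the disc, locally uniform convergence is uniform convergence on compact subsets, so the
  sets \<open>{g \<in> \<A>. \<forall>z\<in>K. dist (g z) (f z) < e}\<close> with \<open>K\<close> compact and
  \<open>e > 0\<close> form a neighbourhood base at \<open>f\<close>.
\<close>

definition locally_uniform_topology :: "(complex \<Rightarrow> complex) topology"
  where "locally_uniform_topology = topology (\<lambda>U. U \<subseteq> \<A> \<and>
    (\<forall>f\<in>U. \<exists>K e. compact K \<and> K \<subseteq> \<D> \<and> 0 < e \<and> {g \<in> \<A>. \<forall>z\<in>K. dist (g z) (f z) < e} \<subseteq> U))"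

lemma openin_locally_uniform_topology:
  "openin locally_uniform_topology U \<longleftrightarrow> U \<subseteq> \<A> \<and>
    (\<forall>f\<in>U. \<exists>K e. compact K \<and> K \<subseteq> \<D> \<and> 0 < e \<and> {g \<in> \<A>. \<forall>z\<in>K. dist (g z) (f z) < e} \<subseteq> U)"
proof -
  define P where "P U \<longleftrightarrow> U \<subseteq> \<A> \<and>
    (\<forall>f\<in>U. \<exists>K e. compact K \<and> K \<subseteq> \<D> \<and> 0 < e \<and> {g \<in> \<A>. \<forall>z\<in>K. dist (g z) (f z) < e} \<subseteq> U)" for U
  have "istopology P"
    unfolding istopology_def
  proof (intro conjI allI impI)
    fix S T assume ST: "P S" "P T"
    show "P (S \<inter> T)"
      unfolding P_def
    proof (intro conjI ballI)
      show "S \<inter> T \<subseteq> \<A>" using ST by (auto simp: P_def)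
      fix f assume f: "f \<in> S \<inter> T"
      obtain K e where K: "compact K" "K \<subseteq> \<D>" "0 < e" "{g \<in> \<A>. \<forall>z\<in>K. dist (g z) (f z) < e} \<subseteq> S"
        using ST(1) f unfolding P_def by blast
      obtain L d where L: "compact L" "L \<subseteq> \<D>" "0 < d" "{g \<in> \<A>. \<forall>z\<in>L. dist (g z) (f z) < d} \<subseteq> T"
        using ST(2) f unfolding P_def by blast
      have "{g \<in> \<A>. \<forall>z\<in>K \<union> L. dist (g z) (f z) < min e d} \<subseteq> S \<inter> T"
        using K(4) L(4) by auto
      then show "\<exists>K e. compact K \<and> K \<subseteq> \<D> \<and> 0 < e \<and> {g \<in> \<A>. \<forall>z\<in>K. dist (g z) (f z) < e} \<subseteq> S \<inter> T"
        using K L by (intro exI[of _ "K \<union> L"] exI[of _ "min e d"]) (simp add: compact_Un)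
    qed
  next
    fix \<K> assume \<K>: "\<forall>K\<in>\<K>. P K"
    show "P (\<Union>\<K>)"
      unfolding P_def
    proof (intro conjI ballI)
      show "\<Union>\<K> \<subseteq> \<A>" using \<K> by (auto simp: P_def)
      fix f assume "f \<in> \<Union>\<K>"
      then obtain S where S: "S \<in> \<K>" "f \<in> S" by blast
      have "P S" using \<K> S(1) by (rule bspec)
      then obtain K e where "compact K" "K \<subseteq> \<D>" "0 < e" "{g \<in> \<A>. \<forall>z\<in>K. dist (g z) (f z) < e} \<subseteq> S"
        using S(2) unfolding P_def by blast
      moreover from this(4) have "{g \<in> \<A>. \<forall>z\<in>K. dist (g z) (f z) < e} \<subseteq> \<Union>\<K>"
        using S(1) by (rule subset_trans [OF _ Union_upper])
      ultimately show "\<exists>K e. compact K \<and> K \<subseteq> \<D> \<and> 0 < e \<and> {g \<in> \<A>. \<forall>z\<in>K. dist (g z) (f z) < e} \<subseteq> \<Union>\<K>"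
        by (intro exI conjI)
    qed
  qed
  then have "openin (topology P) U = P U"
    by (simp add: topology_inverse')
  then show ?thesis
    by (simp add: locally_uniform_topology_def P_def [abs_def])
qed

lemma topspace_locally_uniform_topology [simp]: "topspace locally_uniform_topology = \<A>"
proof
  show "topspace locally_uniform_topology \<subseteq> \<A>"
    using openin_topspace [of locally_uniform_topology]
    unfolding openin_locally_uniform_topology by (rule conjunct1)
  have "openin locally_uniform_topology \<A>"
    unfolding openin_locally_uniform_topology
    by (intro conjI ballI subset_refl exI[of _ "{}"] exI[of _ 1]) auto
  then show "\<A> \<subseteq> topspace locally_uniform_topology"
    by (rule openin_subset)
qed

definition ordered_pairs :: "real set \<Rightarrow> (real \<times> real) set"
  where "ordered_pairs I = {(s, t). s \<in> I \<and> t \<in> I \<and> s \<le> t}"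

definition evolution_family :: "real set \<Rightarrow> (real \<Rightarrow> real \<Rightarrow> complex \<Rightarrow> complex) \<Rightarrow> bool"
  where "evolution_family I \<omega> \<longleftrightarrow>
    (\<forall>(s, t)\<in>ordered_pairs I. \<omega> s t \<in> \<BB>) \<and>
    (\<forall>(s, t)\<in>ordered_pairs I. \<not> \<omega> s t constant_on \<D>) \<and>
    (\<forall>t\<in>I. \<forall>z\<in>\<D>. \<omega> t t z = z) \<and>
    (\<forall>s\<in>I. \<forall>u\<in>I. \<forall>t\<in>I. s \<le> u \<and> u \<le> t \<longrightarrow> (\<forall>z\<in>\<D>. \<omega> u t (\<omega> s u z) = \<omega> s t z))"

definition jointly_continuous :: "real set \<Rightarrow> (real \<Rightarrow> real \<Rightarrow> complex \<Rightarrow> complex) \<Rightarrow> bool"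
  where "jointly_continuous I \<omega> \<longleftrightarrow>
    continuous_map (top_of_set (ordered_pairs I)) locally_uniform_topology (\<lambda>(s, t). \<omega> s t)"

definition continuous_in_left_parameter ::
    "real \<Rightarrow> real \<Rightarrow> (real \<Rightarrow> real \<Rightarrow> complex \<Rightarrow> complex) \<Rightarrow> bool"
  where "continuous_in_left_parameter a b \<omega> \<longleftrightarrow>
    continuous_map (top_of_set {a..b}) locally_uniform_topology (\<lambda>s. \<omega> s b)"

text \<open>
  For an evolution family on a nonempty interval this supremum is over a nonempty set of reals
  bounded above by 1.
\<close>

definition hyperbolically_bounded :: "real set \<Rightarrow> (real \<Rightarrow> real \<Rightarrow> complex \<Rightarrow> complex) \<Rightarrow> bool"
  where "hyperbolically_bounded I \<omega> \<longleftrightarrow> (SUP (s, t)\<in>ordered_pairs I. cmod (\<omega> s t 0)) < 1"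

text \<open>
  The filter on pairs \<open>(s, t)\<close> of points of \<open>[a, b]\<close> with \<open>s \<le> c \<le> t\<close>, as \<open>t - s\<close>
  decreases to 0.
\<close>

definition shrinking_to :: "real \<Rightarrow> real \<Rightarrow> real \<Rightarrow> (real \<times> real) filter"
  where "shrinking_to a b c =
    inf (filtercomap (\<lambda>(s, t). t - s) (at_right 0))
        (principal {(s, t). s \<in> {a..b} \<and> t \<in> {a..b} \<and> s \<le> c \<and> c \<le> t})"

end

theory Submission
  imports Defs
begin

text \<open>
  Write \<open>g\<^sub>t\<close> for \<open>\<omega> t b\<close>, so that \<open>g\<^sub>t \<circ> \<omega> s t = g\<^sub>s\<close>.  On maps of the disc into itself,
  pointwise and locally uniform convergence agree, because the Cauchy estimate makes these maps
  equicontinuous; so all continuity statements reduce to sequences and points.  Hyperbolic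
  boundedness \<open>|\<omega> s t 0| \<le> r < 1\<close> supplies compactness: by Montel's theorem and the
  Schwarz-Pick inequality every sequence of maps \<open>\<omega> s t\<close> has a subsequence that converges to
  a self-map of the open disc.

  The pivot is injectivity of the terminal maps \<open>g\<^sub>t\<close>.  Suppose \<open>s \<mapsto> g\<^sub>s\<close> is continuous and
  \<open>\<omega> s\<^sub>n t\<^sub>n\<close> converges to \<open>h\<close> while \<open>(s\<^sub>n, t\<^sub>n)\<close> tends to \<open>(s, t)\<close>.  Then
  \<open>g\<^sub>t \<circ> h = g\<^sub>s = g\<^sub>t \<circ> \<omega> s t\<close>, and \<open>h = \<omega> s t\<close> as soon as \<open>g\<^sub>t\<close> is injective on a disc
  of some radius \<open>\<rho> > r\<close> (\<open>tendsto_of_terminal_injective\<close>).  Conversely, call \<open>c\<close> free of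
  jumps if \<open>\<omega> s t\<close> tends to the identity as \<open>s \<le> c \<le> t\<close> shrink to \<open>c\<close>.  If there are no
  jumps between \<open>s\<close> and \<open>t\<close>, then \<open>\<omega> s t\<close> is injective (\<open>no_jumps_injective\<close>), since it is a
  composition of maps so near to the identity that they are injective where they are needed.

  If \<open>s \<mapsto> g\<^sub>s\<close> is assumed continuous, these two facts are played against each other to propagate injectivity from
  \<open>b\<close> down to \<open>a\<close> (\<open>left_continuous_injective\<close>).  If \<open>g\<^sub>c\<close> is injective, then \<open>c\<close> is free of
  jumps, so for \<open>v\<close> slightly below \<open>c\<close> the map \<open>\<omega> v c\<close>, and with it \<open>g\<^sub>v\<close>, is injective on
  a disc of radius \<open>\<rho> > r\<close>; hence \<open>v\<close> is free of jumps as well, and then \<open>g\<^sub>v\<close> is injective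
  on the whole disc.  In the other direction, Hurwitz's theorem keeps injectivity in the limit.

  If instead the values and derivatives at \<open>0\<close> are controlled, a limit \<open>h\<close> of maps \<open>\<omega> s t\<close> with \<open>s \<le> c \<le> t\<close> shrinking to \<open>c\<close>
  satisfies \<open>h 0 = 0\<close>, and the chain rule together with continuity of \<open>deriv g\<^sub>s 0 \<noteq> 0\<close> gives
  \<open>deriv h 0 = 1\<close>.  The Schwarz lemma makes \<open>h\<close> the identity, so there are no jumps at all;
  this implies that \<open>s \<mapsto> g\<^sub>s\<close> is continuous, which is the case treated before.  That joint
  continuity implies the other conditions follows from compactness of the set of ordered pairs, from convergence of
  derivatives, and from the nonvanishing derivative of an injective map.
\<close>

section \<open>Analytic self-maps of the disc\<close>

lemma mem_analytic_self_maps: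
  "f \<in> \<BB> \<longleftrightarrow> f holomorphic_on \<D> \<and> (\<forall>z. cmod z < 1 \<longrightarrow> cmod (f z) < 1)"
  by (auto simp: analytic_self_maps_def analytic_functions_def image_subset_iff)

lemma self_map_holomorphic: "f \<in> \<BB> \<Longrightarrow> f holomorphic_on \<D>"
  by (simp add: mem_analytic_self_maps)

lemma self_map_norm: "f \<in> \<BB> \<Longrightarrow> cmod z < 1 \<Longrightarrow> cmod (f z) < 1"
  by (simp add: mem_analytic_self_maps)

text \<open>
  The Cauchy estimate on circles of radius \<open>(R - \<rho>) / 2\<close> bounds the derivative.  The constant is
  proportional to \<open>\<epsilon>\<close>: with \<open>\<epsilon> = 1\<close> this gives equicontinuity of all self-maps, and with
  \<open>\<epsilon>\<close> small it shows that a map close to the identity is injective.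
\<close>

lemma holomorphic_lipschitz_cball:
  assumes hol: "h holomorphic_on ball 0 R"
    and bd: "\<And>z. cmod z < R \<Longrightarrow> cmod (h z) \<le> \<epsilon>"
    and "\<rho> < R" and z: "cmod z \<le> \<rho>" and w: "cmod w \<le> \<rho>"
  shows "cmod (h z - h w) \<le> 2 * \<epsilon> / (R - \<rho>) * cmod (z - w)"
proof (rule field_differentiable_bound [of "cball 0 \<rho>" h "deriv h"])
  show "convex (cball (0::complex) \<rho>)" by simp
  show "z \<in> cball 0 \<rho>" "w \<in> cball 0 \<rho>" using z w by auto
  fix u assume "u \<in> cball (0::complex) \<rho>"
  then have u: "cmod u \<le> \<rho>" by simp
  have "(h has_field_derivative deriv h u) (at u)"
    using u \<open>\<rho> < R\<close> by (intro holomorphic_derivI [OF hol]) auto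
  then show "(h has_field_derivative deriv h u) (at u within cball 0 \<rho>)"
    by (rule has_field_derivative_at_within)
  define r where "r = (R - \<rho>) / 2"
  have r: "0 < r" "\<rho> + r < R" using \<open>\<rho> < R\<close> by (auto simp: r_def field_simps)
  have sub: "cball u r \<subseteq> ball 0 R"
  proof
    fix x assume "x \<in> cball u r"
    then have "cmod (x - u) \<le> r" by (simp add: dist_norm norm_minus_commute)
    then show "x \<in> ball 0 R"
      using norm_triangle_ineq [of "x - u" u] u r by simp
  qed
  have "cmod ((deriv ^^ 1) h u) \<le> fact 1 * \<epsilon> / r ^ 1"
  proof (rule Cauchy_inequality)
    show "h holomorphic_on ball u r"
      using hol sub ball_subset_cball by (blast intro: holomorphic_on_subset)
    show "continuous_on (cball u r) h"
      using hol sub by (blast intro: holomorphic_on_imp_continuous_on holomorphic_on_subset)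
    show "cmod (h x) \<le> \<epsilon>" if "cmod (u - x) = r" for x
    proof (rule bd)
      have "x \<in> cball u r" using that by (simp add: dist_norm)
      then show "cmod x < R" using sub by auto
    qed
  qed (use r in auto)
  then show "cmod (deriv h u) \<le> 2 * \<epsilon> / (R - \<rho>)"
    by (simp add: r_def mult.commute)
qed

lemma self_map_lipschitz:
  assumes "f \<in> \<BB>" and "\<rho> < 1" "cmod z \<le> \<rho>" "cmod w \<le> \<rho>"
  shows "cmod (f z - f w) \<le> 2 / (1 - \<rho>) * cmod (z - w)"
proof -
  have "cmod (f z - f w) \<le> 2 * 1 / (1 - \<rho>) * cmod (z - w)"
    using assms by (intro holomorphic_lipschitz_cball)
      (auto simp: mem_analytic_self_maps intro: less_imp_le)
  then show ?thesis by simp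
qed

text \<open>
  A quantitative form of the Schwarz-Pick inequality: if \<open>M\<close> is the disc automorphism that takes
  \<open>f 0\<close> to \<open>0\<close>, the Schwarz lemma applies to \<open>M \<circ> f\<close>, and the bound for \<open>M (f z)\<close> turns into
  \<open>(1 - \<rho>\<^sup>2) (1 - r)\<^sup>2 \<le> 1 - |f z|\<^sup>2\<close>.  What matters is that one radius \<open>R\<close> serves all maps.
\<close>

lemma self_map_compact_image:
  assumes "r < 1" "\<rho> < 1"
  obtains R where "R < 1" "\<And>f z. f \<in> \<BB> \<Longrightarrow> cmod (f 0) \<le> r \<Longrightarrow> cmod z \<le> \<rho> \<Longrightarrow> cmod (f z) \<le> R"
proof -
  define R where "R = sqrt (1 - (1 - \<rho>\<^sup>2) * (1 - r)\<^sup>2)"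
  show thesis
  proof (cases "0 \<le> \<rho>")
    case False
    then have "\<not> cmod z \<le> \<rho>" for z :: complex
      using norm_ge_zero [of z] by linarith
    then show thesis using that [of 0] by simp
  next
    case True
    have "\<rho>\<^sup>2 < 1" using True \<open>\<rho> < 1\<close> by (simp add: power_less_one_iff)
    then have "0 < (1 - \<rho>\<^sup>2) * (1 - r)\<^sup>2" using \<open>r < 1\<close> by simp
    then have "R < 1" by (simp add: R_def)
    moreover have "cmod (f z) \<le> R" if f: "f \<in> \<BB>" and f0: "cmod (f 0) \<le> r" and z: "cmod z \<le> \<rho>" for f z
    proof -
      define M where "M = Moebius_function 0 (f 0)"
      have z1: "cmod z < 1" and f01: "cmod (f 0) < 1" and fz: "cmod (f z) < 1"
        using z \<open>\<rho> < 1\<close> f by (auto intro: self_map_norm)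
      have "cmod ((M \<circ> f) z) \<le> cmod z"
      proof (rule Schwarz_Lemma(1))
        show "M \<circ> f holomorphic_on \<D>"
          unfolding M_def
          using f f01 by (intro holomorphic_on_compose_gen [where t = \<D>] Moebius_function_holomorphic)
            (auto simp: mem_analytic_self_maps)
        show "(M \<circ> f) 0 = 0" by (simp add: M_def Moebius_function_eq_zero)
        show "cmod ((M \<circ> f) u) < 1" if "cmod u < 1" for u
          using f f01 that by (simp add: M_def Moebius_function_norm_lt_1 self_map_norm)
        show "cmod z < 1" by fact
      qed
      then have "cmod (M (f z)) \<le> \<rho>" using z by simp
      then have "(cmod (M (f z)))\<^sup>2 \<le> \<rho>\<^sup>2" by (simp add: power_mono)
      moreover
      have dn: "1 - r \<le> cmod (1 - cnj (f 0) * f z)"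
      proof -
        have "cmod (cnj (f 0) * f z) \<le> r * 1"
          unfolding norm_mult using f0 fz by (intro mult_mono) (auto intro: order_trans [OF norm_ge_zero])
        then show ?thesis using norm_triangle_ineq2 [of 1 "cnj (f 0) * f z"] by simp
      qed
      then have dnp: "0 < cmod (1 - cnj (f 0) * f z)" using \<open>r < 1\<close> by linarith
      \<comment> \<open>The identity behind the invariance of the pseudohyperbolic distance.\<close>
      have id: "(cmod (1 - cnj (f 0) * f z))\<^sup>2 - (cmod (f z - f 0))\<^sup>2 = (1 - (cmod (f 0))\<^sup>2) * (1 - (cmod (f z))\<^sup>2)"
        unfolding cmod_power2 by (simp add: algebra_simps power2_eq_square)
      have "(cmod (M (f z)))\<^sup>2 = (cmod (f z - f 0))\<^sup>2 / (cmod (1 - cnj (f 0) * f z))\<^sup>2"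
        by (simp add: M_def Moebius_function_simple norm_divide power_divide)
      ultimately have "(cmod (f z - f 0))\<^sup>2 \<le> \<rho>\<^sup>2 * (cmod (1 - cnj (f 0) * f z))\<^sup>2"
        using dnp by (simp add: pos_divide_le_eq)
      then have "(1 - \<rho>\<^sup>2) * (cmod (1 - cnj (f 0) * f z))\<^sup>2 \<le> (1 - (cmod (f 0))\<^sup>2) * (1 - (cmod (f z))\<^sup>2)"
        using id by (simp add: algebra_simps)
      also have "\<dots> \<le> 1 * (1 - (cmod (f z))\<^sup>2)"
        using fz by (intro mult_right_mono) (auto simp: power_le_one)
      finally have "(1 - \<rho>\<^sup>2) * (cmod (1 - cnj (f 0) * f z))\<^sup>2 \<le> 1 - (cmod (f z))\<^sup>2" by simp
      moreover have "(1 - \<rho>\<^sup>2) * (1 - r)\<^sup>2 \<le> (1 - \<rho>\<^sup>2) * (cmod (1 - cnj (f 0) * f z))\<^sup>2"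
        using dn \<open>r < 1\<close> \<open>\<rho>\<^sup>2 < 1\<close> by (intro mult_left_mono power_mono) auto
      ultimately have "(cmod (f z))\<^sup>2 \<le> 1 - (1 - \<rho>\<^sup>2) * (1 - r)\<^sup>2" by linarith
      then show ?thesis unfolding R_def by (intro real_le_rsqrt) simp
    qed
    ultimately show thesis using that by blast
  qed
qed

text \<open>
  Convergence at the points of a finite net of \<open>K\<close> suffices, since all the maps share a Lipschitz
  constant on a disc that contains \<open>K\<close>.
\<close>

lemma self_maps_uniform_limit:
  assumes F: "\<And>x. F x \<in> \<BB>" and f: "f \<in> \<BB>"
    and lim: "\<And>z. cmod z < 1 \<Longrightarrow> ((\<lambda>x. F x z) \<longlongrightarrow> f z) Fil"
    and K: "compact K" "K \<subseteq> \<D>"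
  shows "uniform_limit K F f Fil"
proof (rule uniform_limitI)
  fix e :: real assume "0 < e"
  obtain \<rho> where \<rho>: "\<rho> < 1" "\<And>z. z \<in> K \<Longrightarrow> cmod z \<le> \<rho>"
  proof (cases "K = {}")
    case True
    then show ?thesis using that [of 0] by auto
  next
    case False
    obtain x where "x \<in> K" "\<And>y. y \<in> K \<Longrightarrow> cmod y \<le> cmod x"
      using continuous_attains_sup [OF K(1) False, of cmod] by (auto intro: continuous_intros)
    then show ?thesis using that [of "cmod x"] K(2) by auto
  qed
  define L where "L = 2 / (1 - \<rho>)"
  have "0 < L" using \<rho>(1) by (simp add: L_def)
  define \<delta> where "\<delta> = e / (4 * L)"
  have \<delta>: "0 < \<delta>" "L * \<delta> = e / 4" using \<open>0 < e\<close> \<open>0 < L\<close> by (auto simp: \<delta>_def)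
  obtain N where N: "finite N" "N \<subseteq> K" "K \<subseteq> (\<Union>x\<in>N. ball x \<delta>)"
    using compactE_image [OF K(1), of K "\<lambda>x. ball x \<delta>"] \<delta>(1) by (metis (no_types, lifting) UN_I centre_in_ball open_ball subsetI)
  have "\<forall>\<^sub>F x in Fil. \<forall>u\<in>N. dist (F x u) (f u) < e / 4"
  proof (intro eventually_ball_finite N(1) ballI)
    fix u assume "u \<in> N"
    then have "cmod u < 1" using N(2) K(2) by auto
    then show "\<forall>\<^sub>F x in Fil. dist (F x u) (f u) < e / 4"
      using \<open>0 < e\<close> by (intro tendstoD [OF lim]) auto
  qed
  then show "\<forall>\<^sub>F x in Fil. \<forall>z\<in>K. dist (F x z) (f z) < e"
  proof eventually_elim
    case (elim x)
    show ?case
    proof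
      fix z assume z: "z \<in> K"
      then obtain u where u: "u \<in> N" "dist u z < \<delta>" using N(3) by auto
      then have zu: "cmod z \<le> \<rho>" "cmod u \<le> \<rho>" "cmod (z - u) < \<delta>" 
        using z \<rho>(2) N(2) by (auto simp: dist_norm norm_minus_commute)
      have near: "cmod (g z - g u) \<le> e / 4" if "g \<in> \<BB>" for g
      proof -
        have "cmod (g z - g u) \<le> L * cmod (z - u)"
          unfolding L_def using that zu \<rho>(1) by (intro self_map_lipschitz)
        also have "\<dots> \<le> L * \<delta>" using zu(3) \<open>0 < L\<close> by simp
        finally show ?thesis using \<delta>(2) by simp
      qed
      have "dist (F x u) (f u) < e / 4" using elim u(1) by blast
      then have "dist (F x z) (f z) < e / 4 + e / 4 + e / 4"
        using near [OF F [of x]] near [OF f] 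
          dist_triangle [of "F x z" "f z" "F x u"] dist_triangle [of "F x u" "f z" "f u"]
        by (simp add: dist_norm norm_minus_commute)
      then show "dist (F x z) (f z) < e" using \<open>0 < e\<close> by simp
    qed
  qed
qed

text \<open>
  Equicontinuity allows a moving point to be replaced by its limit, even when the maps do not
  converge.
\<close>

lemma self_maps_asymptotic_at_point:
  assumes G: "\<And>x. G x \<in> \<BB>" and p: "(p \<longlongrightarrow> q) Fil" and q: "cmod q < 1"
  shows "((\<lambda>x. G x (p x) - G x q) \<longlongrightarrow> 0) Fil"
proof (rule Lim_null_comparison)
  define \<rho> where "\<rho> = (1 + cmod q) / 2"
  have \<rho>: "\<rho> < 1" "cmod q < \<rho>" using q by (auto simp: \<rho>_def)
  have "((\<lambda>x. cmod (p x)) \<longlongrightarrow> cmod q) Fil" using p by (rule tendsto_norm)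
  then have "\<forall>\<^sub>F x in Fil. cmod (p x) < \<rho>" using \<rho>(2) by (rule order_tendstoD)
  then show "\<forall>\<^sub>F x in Fil. cmod (G x (p x) - G x q) \<le> 2 / (1 - \<rho>) * cmod (p x - q)"
  proof eventually_elim
    case (elim x)
    then show ?case using \<rho> by (intro self_map_lipschitz G) auto
  qed
  have "((\<lambda>x. cmod (p x - q)) \<longlongrightarrow> 0) Fil"
    using p by (simp add: LIM_zero_iff tendsto_norm_zero)
  then show "((\<lambda>x. 2 / (1 - \<rho>) * cmod (p x - q)) \<longlongrightarrow> 0) Fil"
    by (rule tendsto_mult_right_zero)
qed

lemma self_maps_tendsto_compose:
  assumes "\<And>x. G x \<in> \<BB>" and "(p \<longlongrightarrow> q) Fil" and "cmod q < 1"
    and lim: "((\<lambda>x. G x q) \<longlongrightarrow> l) Fil"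
  shows "((\<lambda>x. G x (p x)) \<longlongrightarrow> l) Fil"
  using tendsto_add [OF self_maps_asymptotic_at_point [where G = G, OF assms(1-3)] lim] by simp

lemma self_maps_tendsto_deriv:
  assumes F: "\<And>n. F n \<in> \<BB>" and f: "f \<in> \<BB>"
    and lim: "\<And>z. cmod z < 1 \<Longrightarrow> ((\<lambda>n. F n z) \<longlongrightarrow> f z) Fil"
    and "Fil \<noteq> bot"
  shows "((\<lambda>n. deriv (F n) 0) \<longlongrightarrow> deriv f 0) Fil"
proof -
  have "uniform_limit (cball 0 (1/2)) F f Fil"
    by (rule self_maps_uniform_limit [OF F f lim]) auto
  then have "uniform_limit (ball 0 (1/2)) F f Fil"
    by (rule uniform_limit_on_subset) auto
  moreover have "\<forall>\<^sub>F n in Fil. F n holomorphic_on ball 0 (1/2)"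
    by (rule always_eventually) (auto intro: holomorphic_on_subset [OF self_map_holomorphic [OF F]])
  ultimately have "((\<lambda>n. deriv (F n) 0) \<longlongrightarrow> deriv f 0) Fil"
    using \<open>Fil \<noteq> bot\<close> by (rule deriv_complex_uniform_limit) auto
  then show ?thesis by simp
qed

text \<open>
  On \<open>cball 0 \<rho>\<close> the difference \<open>F n z - z\<close> eventually has Lipschitz constant at most \<open>1 / 2\<close>, too
  small to cancel the displacement of the identity.
\<close>

lemma self_maps_near_identity_injective:
  assumes F: "\<And>n. F n \<in> \<BB>"
    and lim: "\<And>z. cmod z < 1 \<Longrightarrow> ((\<lambda>n. F n z) \<longlongrightarrow> z) Fil"
    and "\<rho> < 1"
  shows "\<forall>\<^sub>F n in Fil. inj_on (F n) (cball 0 \<rho>)"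
proof -
  define R where "R = (1 + \<rho>) / 2"
  have R: "\<rho> < R" "R < 1" using \<open>\<rho> < 1\<close> by (auto simp: R_def)
  have "uniform_limit (cball 0 R) F (\<lambda>z. z) Fil"
    using R by (intro self_maps_uniform_limit F lim) (auto simp: mem_analytic_self_maps)
  then have "\<forall>\<^sub>F n in Fil. \<forall>z\<in>cball 0 R. dist (F n z) z < (R - \<rho>) / 4"
    using R by (intro uniform_limitD) auto
  then show ?thesis
  proof eventually_elim
    case (elim n)
    show ?case
    proof (rule inj_onI)
      fix z w assume zw: "z \<in> cball 0 \<rho>" "w \<in> cball 0 \<rho>" and eq: "F n z = F n w"
      have "cmod ((F n z - z) - (F n w - w)) \<le> 2 * ((R - \<rho>) / 4) / (R - \<rho>) * cmod (z - w)"
      proof (rule holomorphic_lipschitz_cball)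
        show "(\<lambda>z. F n z - z) holomorphic_on ball 0 R"
          using R by (intro holomorphic_intros holomorphic_on_subset [OF self_map_holomorphic [OF F]]) auto
        show "cmod (F n u - u) \<le> (R - \<rho>) / 4" if "cmod u < R" for u
          using elim that by (auto simp: dist_norm intro: less_imp_le)
      qed (use zw R in auto)
      also have "2 * ((R - \<rho>) / 4) / (R - \<rho>) = 1 / 2" using R by (simp add: divide_simps)
      finally have "cmod (w - z) \<le> 1 / 2 * cmod (z - w)" using eq by simp
      then show "z = w" by (simp add: norm_minus_commute)
    qed
  qed
qed

text \<open>
  The bound at \<open>0\<close> cannot be omitted: it keeps Montel's limit away from the boundary, so that
  the limit maps the disc into the open disc and not to a unimodular constant.
\<close>

lemma self_maps_subsequential_limit:
  fixes F :: "nat \<Rightarrow> complex \<Rightarrow> complex"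
  assumes F: "\<And>n. F n \<in> \<BB>" and F0: "\<And>n. cmod (F n 0) \<le> r" and "r < 1"
  obtains \<sigma> f where "strict_mono \<sigma>" "f \<in> \<BB>" "\<And>z. cmod z < 1 \<Longrightarrow> (\<lambda>n::nat. F (\<sigma> n) z) \<longlonglongrightarrow> f z"
proof -
  obtain f \<sigma> where f: "f holomorphic_on \<D>" and \<sigma>: "strict_mono \<sigma>"
    and lim: "\<And>z. z \<in> \<D> \<Longrightarrow> (\<lambda>n. F (\<sigma> n) z) \<longlonglongrightarrow> f z"
  proof (rule Montel [of \<D> \<BB> F])
    show "\<exists>B. \<forall>h\<in>\<BB>. \<forall>z\<in>K. cmod (h z) \<le> B" if "compact K" "K \<subseteq> \<D>" for K
      using that(2) by (intro exI [of _ 1] ballI less_imp_le [OF self_map_norm]) auto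
  qed (use F in \<open>auto intro: self_map_holomorphic\<close>)
  have "cmod (f z) < 1" if z: "cmod z < 1" for z
  proof -
    obtain R where R: "R < 1" "\<And>f w. f \<in> \<BB> \<Longrightarrow> cmod (f 0) \<le> r \<Longrightarrow> cmod w \<le> cmod z \<Longrightarrow> cmod (f w) \<le> R"
      using self_map_compact_image [OF \<open>r < 1\<close> z] by metis
    have "cmod (f z) \<le> R"
      using tendsto_norm [OF lim [of z]] z F F0
      by (intro LIMSEQ_le_const2 [where X = "\<lambda>n. cmod (F (\<sigma> n) z)"]) (auto intro: R(2))
    then show ?thesis using R(1) by simp
  qed
  then show thesis using that [OF \<sigma>, of f] f lim by (simp add: mem_analytic_self_maps)
qed

text \<open>
  Identifying the limits of convergent subsequences is enough, because by compactness a sequence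
  that fails to converge at \<open>z\<close> would have a convergent subsequence with another limit there.
\<close>

lemma self_maps_tendsto_by_subsequences:
  assumes F: "\<And>n. F n \<in> \<BB>" and F0: "\<And>n. cmod (F n 0) \<le> r" and "r < 1"
    and unique: "\<And>\<sigma> h. strict_mono \<sigma> \<Longrightarrow> h \<in> \<BB> \<Longrightarrow>
      (\<And>z. cmod z < 1 \<Longrightarrow> (\<lambda>n::nat. F (\<sigma> n) z) \<longlonglongrightarrow> h z) \<Longrightarrow> (\<And>z. cmod z < 1 \<Longrightarrow> h z = f z)"
    and z: "cmod z < 1"
  shows "(\<lambda>n. F n z) \<longlonglongrightarrow> f z"
proof (rule ccontr)
  assume "\<not> ?thesis"
  then obtain e where e: "0 < e" "\<not> (\<forall>\<^sub>F n in sequentially. dist (F n z) (f z) < e)"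
    unfolding tendsto_iff by blast
  then have "infinite {n. \<not> dist (F n z) (f z) < e}"
    by (simp add: frequently_cofinite [symmetric] cofinite_eq_sequentially not_eventually)
  then obtain \<tau> :: "nat \<Rightarrow> nat" where \<tau>: "strict_mono \<tau>" "\<And>n. \<not> dist (F (\<tau> n) z) (f z) < e"
    using infinite_enumerate by blast
  obtain \<sigma> h where \<sigma>: "strict_mono \<sigma>" and h: "h \<in> \<BB>" "\<And>z. cmod z < 1 \<Longrightarrow> (\<lambda>n. F (\<tau> (\<sigma> n)) z) \<longlonglongrightarrow> h z"
    using self_maps_subsequential_limit [where F = "\<lambda>n. F (\<tau> n)", OF F F0 \<open>r < 1\<close>] by blast
  have "h z = f z"
    using unique [of "\<tau> \<circ> \<sigma>" h] \<tau>(1) \<sigma> h z by (simp add: strict_mono_o)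
  then have "(\<lambda>n. F (\<tau> (\<sigma> n)) z) \<longlonglongrightarrow> f z" using h(2) [OF z] by simp
  then have "\<forall>\<^sub>F n in sequentially. dist (F (\<tau> (\<sigma> n)) z) (f z) < e" using e(1) by (rule tendstoD)
  then show False using \<tau>(2) by (simp add: eventually_False)
qed

lemma self_maps_limit_injective:
  assumes F: "\<And>n. F n \<in> \<BB>" and f: "f \<in> \<BB>" "\<not> f constant_on \<D>"
    and lim: "\<And>z. cmod z < 1 \<Longrightarrow> (\<lambda>n. F n z) \<longlonglongrightarrow> f z"
    and inj: "\<And>n. inj_on (F n) \<D>"
  shows "inj_on f \<D>"
  using F f inj by (intro Hurwitz_injective [of \<D> F f])
    (auto intro: self_map_holomorphic self_maps_uniform_limit lim)

lemma self_map_eqI: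
  assumes f: "f \<in> \<BB>" and g: "g \<in> \<BB>" and near: "\<forall>\<^sub>F z in nhds 0. f z = g z" and z: "cmod z < 1"
  shows "f z = g z"
proof -
  obtain S where S: "open S" "0 \<in> S" "\<And>z. z \<in> S \<Longrightarrow> f z = g z"
    using near unfolding eventually_nhds by blast
  show ?thesis
  proof (rule analytic_continuation_open [of "S \<inter> \<D>" \<D> f g])
    show "S \<inter> \<D> \<noteq> {}" using S(2) by auto
  qed (use S f g z in \<open>auto intro: self_map_holomorphic\<close>)
qed

lemma self_map_eq_identity:
  assumes f: "f \<in> \<BB>" and "f 0 = 0" and "deriv f 0 = 1" and z: "cmod z < 1"
  shows "f z = z"
proof -
  obtain \<alpha> where \<alpha>: "\<And>z. cmod z < 1 \<Longrightarrow> f z = \<alpha> * z"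
    using Schwarz_Lemma(3) [of f 0] assms by (auto simp: mem_analytic_self_maps)
  have "deriv f 0 = deriv (\<lambda>z. \<alpha> * z) 0"
  proof (rule deriv_cong_ev)
    have "\<forall>\<^sub>F z in nhds 0. z \<in> \<D>" by (intro eventually_nhds_in_open) auto
    then show "\<forall>\<^sub>F z in nhds 0. f z = \<alpha> * z"
      by eventually_elim (simp add: \<alpha>)
  qed simp
  then have "\<alpha> = 1" using \<open>deriv f 0 = 1\<close> by simp
  then show ?thesis using \<alpha> [OF z] by simp
qed

section \<open>The topology on families of self-maps\<close>

text \<open>
  For families of self-maps the topology of locally uniform convergence may be replaced by
  continuity at each point of the disc.
\<close>

lemma continuous_map_locally_uniform_iff:
  fixes F :: "'a::metric_space \<Rightarrow> complex \<Rightarrow> complex"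
  assumes F: "\<And>x. x \<in> X \<Longrightarrow> F x \<in> \<BB>"
  shows "continuous_map (top_of_set X) locally_uniform_topology F \<longleftrightarrow>
    (\<forall>z. cmod z < 1 \<longrightarrow> continuous_on X (\<lambda>x. F x z))"
proof (intro iffI allI impI)
  assume cont: "continuous_map (top_of_set X) locally_uniform_topology F"
  fix z :: complex assume z: "cmod z < 1"
  have "continuous_map locally_uniform_topology euclidean (\<lambda>f. f z)"
    unfolding continuous_map_def
  proof (intro conjI allI impI)
    fix U :: "complex set" assume "openin euclidean U"
    then have U: "open U" by simp
    show "openin locally_uniform_topology {f \<in> topspace locally_uniform_topology. f z \<in> U}"
      unfolding openin_locally_uniform_topology
    proof (intro conjI ballI)
      fix f assume "f \<in> {f \<in> topspace locally_uniform_topology. f z \<in> U}"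
      then obtain e where e: "0 < e" "ball (f z) e \<subseteq> U" using U openE by blast
      then show "\<exists>K e. compact K \<and> K \<subseteq> \<D> \<and> 0 < e \<and> {g \<in> \<A>. \<forall>z\<in>K. dist (g z) (f z) < e}
          \<subseteq> {f \<in> topspace locally_uniform_topology. f z \<in> U}"
        using z by (intro exI [of _ "{z}"] exI [of _ e]) (auto simp: subset_iff dist_commute)
    qed auto
  qed auto
  from continuous_map_compose [OF cont this] show "continuous_on X (\<lambda>x. F x z)"
    by (simp add: o_def)
next
  assume cont: "\<forall>z. cmod z < 1 \<longrightarrow> continuous_on X (\<lambda>x. F x z)"
  show "continuous_map (top_of_set X) locally_uniform_topology F"
    unfolding continuous_map_def
  proof (intro conjI allI impI)
    show "F \<in> topspace (top_of_set X) \<rightarrow> topspace locally_uniform_topology"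
      using F by (auto simp: analytic_self_maps_def)
    fix U assume U: "openin locally_uniform_topology U"
    have "\<exists>d>0. \<forall>y\<in>X. dist y x < d \<longrightarrow> F y \<in> U" if x: "x \<in> X" "F x \<in> U" for x
    proof -
      obtain K e where K: "compact K" "K \<subseteq> \<D>" "0 < e" "{g \<in> \<A>. \<forall>z\<in>K. dist (g z) (F x z) < e} \<subseteq> U"
        using U x unfolding openin_locally_uniform_topology by blast
      \<comment> \<open>Off \<open>X\<close> the family is arbitrary, and it is made constant to consist of self-maps throughout.\<close>
      define G where "G y = (if y \<in> X then F y else F x)" for y
      have "uniform_limit K G (F x) (at x within X)"
      proof (rule self_maps_uniform_limit)
        show "G y \<in> \<BB>" for y using F x by (simp add: G_def)
        show "((\<lambda>y. G y z) \<longlongrightarrow> F x z) (at x within X)" if "cmod z < 1" for z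
        proof (rule Lim_transform_within [where d = 1])
          show "((\<lambda>y. F y z) \<longlongrightarrow> F x z) (at x within X)"
            using cont that x by (simp add: continuous_on_def)
        qed (auto simp: G_def)
      qed (use K F x in auto)
      then have "\<forall>\<^sub>F y in at x within X. \<forall>z\<in>K. dist (G y z) (F x z) < e"
        using K(3) by (rule uniform_limitD)
      then obtain d where d: "0 < d" "\<And>y. y \<in> X \<Longrightarrow> y \<noteq> x \<Longrightarrow> dist y x < d \<Longrightarrow> \<forall>z\<in>K. dist (G y z) (F x z) < e"
        unfolding eventually_at by blast
      have "F y \<in> U" if "y \<in> X" "dist y x < d" for y
      proof (cases "y = x")
        case False
        then have "F y \<in> {g \<in> \<A>. \<forall>z\<in>K. dist (g z) (F x z) < e}"
          using d(2) [OF that(1) False that(2)] that(1) F by (auto simp: G_def analytic_self_maps_def)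
        then show ?thesis using K(4) by blast
      qed (use x in simp)
      then show ?thesis using d(1) by blast
    qed
    then show "openin (top_of_set X) {x \<in> topspace (top_of_set X). F x \<in> U}"
      by (auto simp: openin_euclidean_subtopology_iff)
  qed
qed

lemma tendsto_of_squeezed:
  fixes \<sigma> \<tau> :: "nat \<Rightarrow> real"
  assumes "\<And>n. \<sigma> n \<le> c" "\<And>n. c \<le> \<tau> n" "\<And>n. \<tau> n - \<sigma> n < inverse (real (Suc n))"
  shows "\<sigma> \<longlonglongrightarrow> c" "\<tau> \<longlonglongrightarrow> c"
proof -
  have "norm (\<sigma> n - c) \<le> inverse (real (Suc n)) \<and> norm (\<tau> n - c) \<le> inverse (real (Suc n))" for n
    using assms(1) [of n] assms(2) [of n] assms(3) [of n] unfolding real_norm_def by linarith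
  then have "\<forall>\<^sub>F n in sequentially. norm (\<sigma> n - c) \<le> inverse (real (Suc n))"
    "\<forall>\<^sub>F n in sequentially. norm (\<tau> n - c) \<le> inverse (real (Suc n))"
    by (blast intro: always_eventually)+
  then have "(\<lambda>n. \<sigma> n - c) \<longlonglongrightarrow> 0" "(\<lambda>n. \<tau> n - c) \<longlonglongrightarrow> 0"
    by (blast intro: Lim_null_comparison [OF _ LIMSEQ_inverse_real_of_nat])+
  then show "\<sigma> \<longlonglongrightarrow> c" "\<tau> \<longlonglongrightarrow> c"
    by (auto intro: LIM_zero_cancel)
qed

lemma evolution_family_self_map:
  assumes "evolution_family {a..b} \<omega>" "a \<le> s" "s \<le> t" "t \<le> b"
  shows "\<omega> s t \<in> \<BB>"
  using assms unfolding evolution_family_def ordered_pairs_def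
  by (elim conjE) (drule bspec [of _ _ "(s,t)"], simp, drule bspec [of _ _ "(s,t)"], simp, simp)

section \<open>Evolution families with a uniform hyperbolic bound\<close>

locale bounded_evolution =
  fixes a b :: real and \<omega> :: "real \<Rightarrow> real \<Rightarrow> complex \<Rightarrow> complex" and r :: real
  assumes evolution: "evolution_family {a..b} \<omega>"
    and r: "r < 1"
    and bound: "\<And>s t. a \<le> s \<Longrightarrow> s \<le> t \<Longrightarrow> t \<le> b \<Longrightarrow> cmod (\<omega> s t 0) \<le> r"
begin

lemma self_map: "a \<le> s \<Longrightarrow> s \<le> t \<Longrightarrow> t \<le> b \<Longrightarrow> \<omega> s t \<in> \<BB>"
  using evolution by (rule evolution_family_self_map)

lemma nonconstant: "a \<le> s \<Longrightarrow> s \<le> t \<Longrightarrow> t \<le> b \<Longrightarrow> \<not> \<omega> s t constant_on \<D>"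
  using evolution unfolding evolution_family_def ordered_pairs_def
  by (elim conjE) (drule bspec [of _ _ "(s,t)"], simp, drule bspec [of _ _ "(s,t)"], simp, simp)

lemma identity: "a \<le> t \<Longrightarrow> t \<le> b \<Longrightarrow> cmod z < 1 \<Longrightarrow> \<omega> t t z = z"
  using evolution unfolding evolution_family_def
  by (elim conjE) (meson atLeastAtMost_iff mem_ball_0)

lemma compose: "a \<le> s \<Longrightarrow> s \<le> u \<Longrightarrow> u \<le> t \<Longrightarrow> t \<le> b \<Longrightarrow> cmod z < 1 \<Longrightarrow> \<omega> u t (\<omega> s u z) = \<omega> s t z"
  using evolution unfolding evolution_family_def
  by (elim conjE) (meson atLeastAtMost_iff mem_ball_0 order_trans)

lemma norm_lt_1: "a \<le> s \<Longrightarrow> s \<le> t \<Longrightarrow> t \<le> b \<Longrightarrow> cmod z < 1 \<Longrightarrow> cmod (\<omega> s t z) < 1"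
  using self_map by (rule self_map_norm)

lemma inj_on_compose:
  assumes "a \<le> s" "s \<le> u" "u \<le> t" "t \<le> b" and "A \<subseteq> \<D>"
    and inj_su: "inj_on (\<omega> s u) A" and inj_ut: "inj_on (\<omega> u t) \<D>"
  shows "inj_on (\<omega> s t) A"
proof -
  have "u \<le> b" using \<open>u \<le> t\<close> \<open>t \<le> b\<close> by (rule order_trans)
  have disc: "cmod z < 1" if "z \<in> A" for z using that \<open>A \<subseteq> \<D>\<close> by auto
  have "\<omega> s u ` A \<subseteq> \<D>"
    using norm_lt_1 [OF \<open>a \<le> s\<close> \<open>s \<le> u\<close> \<open>u \<le> b\<close> disc] by auto
  then have "inj_on (\<omega> u t \<circ> \<omega> s u) A"
    using inj_ut by (intro comp_inj_on inj_su) (rule inj_on_subset)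
  moreover have "(\<omega> u t \<circ> \<omega> s u) z = \<omega> s t z" if "z \<in> A" for z
    using compose [OF assms(1-4) disc [OF that]] by simp
  ultimately show ?thesis by (simp cong: inj_on_cong)
qed

text \<open>
  Only intervals around \<open>c\<close> are tested, as in the filter \<open>shrinking_to\<close>.  Constant sequences are
  admitted on either side, so the condition covers one-sided limits at \<open>c\<close>.
\<close>

definition no_jump_at :: "real \<Rightarrow> bool"
  where "no_jump_at c \<longleftrightarrow> (\<forall>\<sigma> \<tau>. (\<forall>n. a \<le> \<sigma> n \<and> \<sigma> n \<le> c \<and> c \<le> \<tau> n \<and> \<tau> n \<le> b) \<and>
    \<sigma> \<longlonglongrightarrow> c \<and> \<tau> \<longlonglongrightarrow> c \<longrightarrow> (\<forall>z. cmod z < 1 \<longrightarrow> (\<lambda>n. \<omega> (\<sigma> n) (\<tau> n) z) \<longlonglongrightarrow> z))"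

text \<open>
  The sequential limit is exchanged for a uniform \<open>d\<close> here, by contradiction, so that the bisection
  principle can be applied to it.
\<close>

lemma no_jump_at_locally_injective:
  assumes c: "no_jump_at c" and "\<rho> < 1"
  obtains d where "0 < d"
    "\<And>s t. a \<le> s \<Longrightarrow> s \<le> c \<Longrightarrow> c \<le> t \<Longrightarrow> t \<le> b \<Longrightarrow> t - s < d \<Longrightarrow> inj_on (\<omega> s t) (cball 0 \<rho>)"
proof (rule ccontr)
  assume no: "\<not> thesis"
  have "\<exists>s t. a \<le> s \<and> s \<le> c \<and> c \<le> t \<and> t \<le> b \<and> t - s < inverse (real (Suc n)) \<and> \<not> inj_on (\<omega> s t) (cball 0 \<rho>)" for n
  proof (rule ccontr)
    assume "\<not> ?thesis"
    then have thesis by (intro that [of "inverse (real (Suc n))"]) (simp, blast)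
    with no show False ..
  qed
  then obtain \<sigma> \<tau> where st: "\<And>n. a \<le> \<sigma> n" "\<And>n. \<sigma> n \<le> c" "\<And>n. c \<le> \<tau> n" "\<And>n. \<tau> n \<le> b"
    "\<And>n. \<tau> n - \<sigma> n < inverse (real (Suc n))" "\<And>n. \<not> inj_on (\<omega> (\<sigma> n) (\<tau> n)) (cball 0 \<rho>)"
    by metis
  have "\<forall>\<^sub>F n in sequentially. inj_on (\<omega> (\<sigma> n) (\<tau> n)) (cball 0 \<rho>)"
  proof (rule self_maps_near_identity_injective)
    show "\<omega> (\<sigma> n) (\<tau> n) \<in> \<BB>" for n
      using st(1-4) [of n] by (intro self_map) linarith+
    show "(\<lambda>n. \<omega> (\<sigma> n) (\<tau> n) z) \<longlonglongrightarrow> z" if "cmod z < 1" for z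
      using c st(1-4) tendsto_of_squeezed [OF st(2,3,5)] that unfolding no_jump_at_def by blast
  qed fact
  then show False using st(6) by (simp add: eventually_False)
qed

text \<open>
  Two orbits \<open>u \<mapsto> \<omega> s u z\<close> and \<open>u \<mapsto> \<omega> s u w\<close> stay in a common disc \<open>cball 0 R\<close>.  Over a short
  interval around any \<open>c\<close> the transition map is injective on this disc, so the orbits cannot
  merge there; the bisection principle turns this into a statement about the whole interval.
\<close>

lemma no_jumps_injective:
  assumes st: "a \<le> s" "s \<le> t" "t \<le> b"
    and no_jump: "\<And>c. s \<le> c \<Longrightarrow> c \<le> t \<Longrightarrow> no_jump_at c"
  shows "inj_on (\<omega> s t) \<D>"
proof (rule inj_onI, rule ccontr)
  fix z w assume "z \<in> \<D>" "w \<in> \<D>" and eq: "\<omega> s t z = \<omega> s t w" and "z \<noteq> w"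
  then have zw: "cmod z < 1" "cmod w < 1" by auto
  obtain R where R: "R < 1" "\<And>f x. f \<in> \<BB> \<Longrightarrow> cmod (f 0) \<le> r \<Longrightarrow> cmod x \<le> max (cmod z) (cmod w) \<Longrightarrow> cmod (f x) \<le> R"
    using self_map_compact_image [OF r, of "max (cmod z) (cmod w)"] zw by auto
  define P where "P u v \<longleftrightarrow> (s \<le> u \<and> v \<le> t \<longrightarrow> \<omega> s u z \<noteq> \<omega> s u w \<longrightarrow> \<omega> s v z \<noteq> \<omega> s v w)" for u v
  have "P s t"
    using \<open>s \<le> t\<close>
  proof (induction rule: Bolzano)
    case (trans u v x)
    then show ?case unfolding P_def by force
  next
    case (local c)
    obtain d where d: "0 < d" "\<And>u v. a \<le> u \<Longrightarrow> u \<le> c \<Longrightarrow> c \<le> v \<Longrightarrow> v \<le> b \<Longrightarrow> v - u < d \<Longrightarrow> inj_on (\<omega> u v) (cball 0 R)"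
      using no_jump_at_locally_injective [OF no_jump [OF local] R(1)] by blast
    have "P u v" if uv: "u \<le> c" "c \<le> v" "v - u < d" for u v
      unfolding P_def
    proof (intro impI)
      assume b: "s \<le> u \<and> v \<le> t" and ne: "\<omega> s u z \<noteq> \<omega> s u w"
      have o: "a \<le> s" "s \<le> u" "u \<le> v" "v \<le> b" "a \<le> u" "u \<le> b" using b uv st by auto
      have "cmod (\<omega> s u z) \<le> R" "cmod (\<omega> s u w) \<le> R"
        using R(2) [OF self_map [of s u] bound [of s u]] o by auto
      then have "\<omega> u v (\<omega> s u z) \<noteq> \<omega> u v (\<omega> s u w)"
        using d(2) [OF \<open>a \<le> u\<close> uv(1,2) \<open>v \<le> b\<close> uv(3)] ne by (auto simp: inj_on_def)
      then show "\<omega> s v z \<noteq> \<omega> s v w" using o zw by (simp add: compose)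
    qed
    then show ?case using d(1) by blast
  qed
  then show False using st zw \<open>z \<noteq> w\<close> eq by (auto simp: P_def identity)
qed

subsection \<open>Continuity of the terminal maps\<close>

definition left_continuous :: bool
  where "left_continuous \<longleftrightarrow> (\<forall>z. cmod z < 1 \<longrightarrow> continuous_on {a..b} (\<lambda>s. \<omega> s b z))"

lemma left_continuous_tendsto:
  assumes left_continuous and "\<And>n. a \<le> \<sigma> n" "\<And>n. \<sigma> n \<le> b" "\<sigma> \<longlonglongrightarrow> s" "a \<le> s" "s \<le> b" "cmod z < 1"
  shows "(\<lambda>n. \<omega> (\<sigma> n) b z) \<longlonglongrightarrow> \<omega> s b z"
  using assms by (intro continuous_on_tendsto_compose [where f = "\<lambda>s. \<omega> s b z"])
    (auto simp: left_continuous_def)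

text \<open>
  A subsequential limit \<open>h\<close> satisfies \<open>\<omega> t b \<circ> h = \<omega> s b = \<omega> t b \<circ> \<omega> s t\<close>.  Both \<open>h\<close> and
  \<open>\<omega> s t\<close> take \<open>0\<close> into \<open>cball 0 r\<close>, so near \<open>0\<close> they take values in the disc on which
  \<open>\<omega> t b\<close> is injective.  They agree near \<open>0\<close>, hence everywhere.  It is essential for the
  propagation below that injectivity is required on one disc of radius \<open>\<rho> > r\<close> only.
\<close>

lemma tendsto_of_terminal_injective:
  assumes left: left_continuous
    and "r < \<rho>" and inj: "inj_on (\<omega> t b) (cball 0 \<rho>)"
    and st: "a \<le> s" "s \<le> t" "t \<le> b"
    and seq: "\<And>n. a \<le> \<sigma> n" "\<And>n. \<sigma> n \<le> \<tau> n" "\<And>n. \<tau> n \<le> b" "\<sigma> \<longlonglongrightarrow> s" "\<tau> \<longlonglongrightarrow> t"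
    and z: "cmod z < 1"
  shows "(\<lambda>n. \<omega> (\<sigma> n) (\<tau> n) z) \<longlonglongrightarrow> \<omega> s t z"
proof (rule self_maps_tendsto_by_subsequences [where F = "\<lambda>n. \<omega> (\<sigma> n) (\<tau> n)" and f = "\<omega> s t"])
  show maps: "\<omega> (\<sigma> n) (\<tau> n) \<in> \<BB>" and bd: "cmod (\<omega> (\<sigma> n) (\<tau> n) 0) \<le> r" for n
    using seq by (auto intro: self_map bound)
  show "r < 1" "cmod z < 1" by (fact r, fact z)
  fix k h z assume k: "strict_mono (k :: nat \<Rightarrow> nat)" and h: "h \<in> \<BB>"
    and lim: "\<And>z. cmod z < 1 \<Longrightarrow> (\<lambda>n. \<omega> (\<sigma> (k n)) (\<tau> (k n)) z) \<longlonglongrightarrow> h z"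
    and z: "cmod z < 1"
  have o: "a \<le> t" "s \<le> b" "\<And>n. a \<le> \<tau> n" "\<And>n. \<sigma> n \<le> b"
    using st seq(1-3) by (meson order_trans)+
  have lims: "(\<lambda>n. \<sigma> (k n)) \<longlonglongrightarrow> s" "(\<lambda>n. \<tau> (k n)) \<longlonglongrightarrow> t"
    using LIMSEQ_subseq_LIMSEQ [OF seq(4) k] LIMSEQ_subseq_LIMSEQ [OF seq(5) k] by (simp_all add: o_def)
  have eq: "\<omega> t b (h x) = \<omega> t b (\<omega> s t x)" if x: "cmod x < 1" for x
  proof -
    have "(\<lambda>n. \<omega> (\<tau> (k n)) b (\<omega> (\<sigma> (k n)) (\<tau> (k n)) x)) \<longlonglongrightarrow> \<omega> t b (h x)"
    proof (rule self_maps_tendsto_compose [where q = "h x" and G = "\<lambda>n. \<omega> (\<tau> (k n)) b"])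
      show "\<omega> (\<tau> (k n)) b \<in> \<BB>" for n using o seq by (intro self_map) auto
      show "cmod (h x) < 1" using h x by (rule self_map_norm)
      then show "(\<lambda>n. \<omega> (\<tau> (k n)) b (h x)) \<longlonglongrightarrow> \<omega> t b (h x)"
        using o seq st lims by (intro left_continuous_tendsto left) auto
    qed (use lim x in auto)
    moreover have "(\<lambda>n. \<omega> (\<sigma> (k n)) b x) \<longlonglongrightarrow> \<omega> s b x"
      using o seq st lims x by (intro left_continuous_tendsto left) auto
    moreover have "\<omega> (\<tau> (k n)) b (\<omega> (\<sigma> (k n)) (\<tau> (k n)) x) = \<omega> (\<sigma> (k n)) b x" for n
      using seq x by (intro compose) auto
    ultimately have "\<omega> t b (h x) = \<omega> s b x"
      by (simp add: LIMSEQ_unique)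
    then show ?thesis using st x by (simp add: compose)
  qed
  have small: "\<forall>\<^sub>F x in nhds 0. cmod (g x) < \<rho>" if g: "g \<in> \<BB>" "cmod (g 0) \<le> r" for g
  proof -
    have "isCont g 0"
      using holomorphic_on_imp_continuous_on [OF self_map_holomorphic [OF g(1)]]
      by (auto simp: continuous_on_eq_continuous_at)
    then have "((\<lambda>x. cmod (g x)) \<longlongrightarrow> cmod (g 0)) (nhds 0)"
      by (intro tendsto_norm) (simp add: isCont_def tendsto_nhds_iff)
    moreover have "cmod (g 0) < \<rho>" using g(2) \<open>r < \<rho>\<close> by simp
    ultimately show ?thesis by (rule order_tendstoD(2))
  qed
  have "cmod (h 0) \<le> r"
    by (rule LIMSEQ_le_const2 [OF tendsto_norm [OF lim [of 0]]]) (use bd in simp_all)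
  then have h_small: "\<forall>\<^sub>F x in nhds 0. cmod (h x) < \<rho>" by (rule small [OF h])
  have w_small: "\<forall>\<^sub>F x in nhds 0. cmod (\<omega> s t x) < \<rho>"
    by (rule small [OF self_map [OF st] bound [OF st]])
  have "\<forall>\<^sub>F x in nhds (0::complex). x \<in> \<D>"
    by (intro eventually_nhds_in_open) auto
  with h_small w_small have "\<forall>\<^sub>F x in nhds 0. h x = \<omega> s t x"
  proof eventually_elim
    case (elim x)
    show ?case by (rule inj_onD [OF inj]) (use elim eq [of x] in simp_all)
  qed
  then show "h z = \<omega> s t z" by (rule self_map_eqI [OF h self_map [OF st] _ z])
qed

lemma no_jump_at_of_terminal_injective:
  assumes left_continuous "r < \<rho>" "inj_on (\<omega> c b) (cball 0 \<rho>)" "a \<le> c" "c \<le> b"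
  shows "no_jump_at c"
  unfolding no_jump_at_def
proof (intro allI impI)
  fix \<sigma> \<tau> :: "nat \<Rightarrow> real" and z :: complex
  assume *: "(\<forall>n. a \<le> \<sigma> n \<and> \<sigma> n \<le> c \<and> c \<le> \<tau> n \<and> \<tau> n \<le> b) \<and> \<sigma> \<longlonglongrightarrow> c \<and> \<tau> \<longlonglongrightarrow> c" and z: "cmod z < 1"
  then have "(\<lambda>n. \<omega> (\<sigma> n) (\<tau> n) z) \<longlonglongrightarrow> \<omega> c c z"
    using assms by (intro tendsto_of_terminal_injective [where \<rho> = \<rho>]) (auto intro: order_trans [of _ c])
  then show "(\<lambda>n. \<omega> (\<sigma> n) (\<tau> n) z) \<longlonglongrightarrow> z" using assms z by (simp add: identity)
qed

text \<open>
  The property \<open>good y\<close>, injectivity of all terminal maps from \<open>y\<close> on, is propagated downwards by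
  bisection.  Below a good \<open>c\<close>, the transition maps \<open>\<omega> v c\<close> are at first known to be injective on
  a disc only; this excludes jumps at \<open>v\<close>, and the absence of jumps gives injectivity on the
  whole disc.  If \<open>c\<close> is not good, then by Hurwitz's theorem no point slightly above \<open>c\<close> is good
  either, and the local condition holds vacuously.
\<close>

lemma left_continuous_injective:
  assumes left: left_continuous and s: "a \<le> s" "s \<le> b"
  shows "inj_on (\<omega> s b) \<D>"
proof -
  define good where "good y \<longleftrightarrow> (\<forall>u. y \<le> u \<and> u \<le> b \<longrightarrow> inj_on (\<omega> u b) \<D>)" for y
  define P where "P x y \<longleftrightarrow> (a \<le> x \<and> y \<le> b \<longrightarrow> good y \<longrightarrow> good x)" for x y
  define \<rho> where "\<rho> = (1 + r) / 2"
  have \<rho>: "r < \<rho>" "\<rho> < 1" using r by (auto simp: \<rho>_def)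
  then have cball: "cball 0 \<rho> \<subseteq> \<D>" by auto
  have "a \<le> b" using s by simp
  then have "P a b"
  proof (induction rule: Bolzano)
    case (trans x y z)
    then show ?case unfolding P_def by force
  next
    case (local c)
    show ?case
    proof (cases "good c")
      case True
      then have inj_c: "inj_on (\<omega> c b) \<D>" using local by (simp add: good_def)
      then have "no_jump_at c"
        using local \<rho> cball by (intro no_jump_at_of_terminal_injective [where \<rho> = \<rho>] left) (auto intro: inj_on_subset)
      then obtain d where d: "0 < d" "\<And>s t. a \<le> s \<Longrightarrow> s \<le> c \<Longrightarrow> c \<le> t \<Longrightarrow> t \<le> b \<Longrightarrow> t - s < d \<Longrightarrow> inj_on (\<omega> s t) (cball 0 \<rho>)"
        using no_jump_at_locally_injective \<rho>(2) by blast
      have no_jump: "no_jump_at v" if v: "a \<le> v" "v \<le> c" "c - v < d" for v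
        using v local d(2) [of v c] inj_c cball \<rho>
        by (intro no_jump_at_of_terminal_injective [where \<rho> = \<rho>] left inj_on_compose [of v c b]) auto
      have "good x" if x: "a \<le> x" "x \<le> c" "c - x < d" for x
        unfolding good_def
      proof (intro allI impI)
        fix u assume u: "x \<le> u \<and> u \<le> b"
        show "inj_on (\<omega> u b) \<D>"
        proof (cases "c \<le> u")
          case True
          then show ?thesis using \<open>good c\<close> u by (simp add: good_def)
        next
          case False
          then have "inj_on (\<omega> u c) \<D>"
            using u x local by (intro no_jumps_injective no_jump) auto
          then show ?thesis using False u x local inj_c by (intro inj_on_compose [of u c b]) auto
        qed
      qed
      then show ?thesis using d(1) unfolding P_def by (intro exI [of _ d]) auto
    next
      case False
      have "\<exists>d>0. \<forall>y. c \<le> y \<and> y \<le> b \<and> y - c < d \<longrightarrow> \<not> good y"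
      proof (rule ccontr)
        assume "\<not> ?thesis"
        then have "\<exists>y. c \<le> y \<and> y \<le> b \<and> y - c < inverse (real (Suc n)) \<and> good y" for n
          by (metis inverse_positive_iff_positive of_nat_0_less_iff zero_less_Suc)
        then obtain \<tau> where \<tau>: "\<And>n. c \<le> \<tau> n" "\<And>n. \<tau> n \<le> b" "\<And>n. \<tau> n - c < inverse (real (Suc n))" "\<And>n. good (\<tau> n)"
          by metis
        have lim: "\<tau> \<longlonglongrightarrow> c" using tendsto_of_squeezed(2) [of "\<lambda>_. c" c \<tau>] \<tau> by simp
        have "inj_on (\<omega> c b) \<D>"
        proof (rule self_maps_limit_injective)
          show "\<omega> (\<tau> n) b \<in> \<BB>" for n using \<tau>(1,2) [of n] local by (intro self_map) linarith+
          show "\<omega> c b \<in> \<BB>" using local by (intro self_map) simp_all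
          show "\<not> \<omega> c b constant_on \<D>" using local by (intro nonconstant) simp_all
          show "inj_on (\<omega> (\<tau> n) b) \<D>" for n using \<tau>(2,4) [of n] by (simp add: good_def)
          show "(\<lambda>n. \<omega> (\<tau> n) b z) \<longlonglongrightarrow> \<omega> c b z" if "cmod z < 1" for z
            using \<tau> local lim that by (intro left_continuous_tendsto left) (auto intro: order_trans [of _ c])
        qed
        moreover have "inj_on (\<omega> u b) \<D>" if "c < u" "u \<le> b" for u
        proof -
          have "\<forall>\<^sub>F n in sequentially. \<tau> n < u" using lim that(1) by (rule order_tendstoD)
          then obtain n where "\<tau> n < u" by (auto simp: eventually_sequentially)
          then show ?thesis using \<tau>(4) [of n] that by (simp add: good_def)
        qed
        ultimately have "good c" by (auto simp: good_def le_less)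
        with False show False ..
      qed
      then obtain d where "0 < d" "\<And>y. c \<le> y \<Longrightarrow> y \<le> b \<Longrightarrow> y - c < d \<Longrightarrow> \<not> good y" by blast
      then show ?thesis unfolding P_def by (intro exI [of _ d]) auto
    qed
  qed
  moreover have "inj_on (\<omega> b b) \<D>"
    using \<open>a \<le> b\<close> by (intro inj_onI) (auto simp: identity)
  then have "good b" unfolding good_def by (metis order_antisym)
  ultimately show ?thesis using s \<open>a \<le> b\<close> by (auto simp: P_def good_def)
qed

lemma jointly_continuous_iff:
  "jointly_continuous {a..b} \<omega> \<longleftrightarrow>
    (\<forall>z. cmod z < 1 \<longrightarrow> continuous_on (ordered_pairs {a..b}) (\<lambda>(s, t). \<omega> s t z))"
  unfolding jointly_continuous_def
  by (subst continuous_map_locally_uniform_iff) (auto simp: ordered_pairs_def case_prod_unfold intro: self_map)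

lemma continuous_in_left_parameter_iff: "continuous_in_left_parameter a b \<omega> \<longleftrightarrow> left_continuous"
  unfolding continuous_in_left_parameter_def left_continuous_def
  by (subst continuous_map_locally_uniform_iff) (auto intro: self_map)

lemma jointly_continuous_of_left_continuous:
  assumes left: left_continuous
  shows "jointly_continuous {a..b} \<omega>"
  unfolding jointly_continuous_iff
proof (intro allI impI continuous_on_sequentiallyI)
  fix z :: complex and u :: "nat \<Rightarrow> real \<times> real" and p
  assume z: "cmod z < 1" and u: "\<forall>n. u n \<in> ordered_pairs {a..b}" and p: "p \<in> ordered_pairs {a..b}"
    and lim: "u \<longlonglongrightarrow> p"
  have o: "a \<le> fst p" "fst p \<le> snd p" "snd p \<le> b" "a \<le> fst (u n)" "fst (u n) \<le> snd (u n)" "snd (u n) \<le> b" for n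
    using p u [rule_format, of n] by (auto simp: ordered_pairs_def)
  define \<rho> where "\<rho> = (1 + r) / 2"
  have \<rho>: "r < \<rho>" "\<rho> < 1" using r by (auto simp: \<rho>_def)
  have "inj_on (\<omega> (snd p) b) \<D>" using left o by (intro left_continuous_injective) auto
  then have inj: "inj_on (\<omega> (snd p) b) (cball 0 \<rho>)" by (rule inj_on_subset) (use \<rho> in auto)
  have "(\<lambda>n. \<omega> (fst (u n)) (snd (u n)) z) \<longlonglongrightarrow> \<omega> (fst p) (snd p) z"
    using lim \<rho> o inj z by (intro tendsto_of_terminal_injective [where \<rho> = \<rho>] left tendsto_fst tendsto_snd) auto
  then show "(\<lambda>n. case u n of (s, t) \<Rightarrow> \<omega> s t z) \<longlonglongrightarrow> (case p of (s, t) \<Rightarrow> \<omega> s t z)"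
    by (simp add: case_prod_unfold)
qed

text \<open>
  If \<open>\<sigma>\<close> and \<open>\<tau>\<close> are the smaller and the larger of \<open>u\<close> and \<open>c\<close>, then \<open>\<omega> \<sigma> b\<close> is the composition of
  \<open>\<omega> \<tau> b\<close> with \<open>\<omega> \<sigma> \<tau>\<close>, which is close to the identity.  In this form the cases \<open>u \<le> c\<close> and
  \<open>u \<ge> c\<close> need no separate treatment.
\<close>

lemma no_jumps_left_continuous:
  assumes no_jump: "\<And>c. a \<le> c \<Longrightarrow> c \<le> b \<Longrightarrow> no_jump_at c"
  shows left_continuous
  unfolding left_continuous_def
proof (intro allI impI continuous_on_sequentiallyI)
  fix z :: complex and u :: "nat \<Rightarrow> real" and c
  assume z: "cmod z < 1" and u: "\<forall>n. u n \<in> {a..b}" and c: "c \<in> {a..b}" and lim: "u \<longlonglongrightarrow> c"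
  define \<sigma> \<tau> where "\<sigma> n = min (u n) c" and "\<tau> n = max (u n) c" for n
  have o: "a \<le> \<sigma> n" "\<sigma> n \<le> c" "c \<le> \<tau> n" "\<tau> n \<le> b" "\<sigma> n \<le> \<tau> n" "a \<le> \<tau> n" for n
    using u [rule_format, of n] c by (auto simp: \<sigma>_def \<tau>_def)
  have "\<sigma> \<longlonglongrightarrow> c" "\<tau> \<longlonglongrightarrow> c"
    using tendsto_min [OF lim tendsto_const [of c]] tendsto_max [OF lim tendsto_const [of c]]
    by (auto simp: \<sigma>_def [abs_def] \<tau>_def [abs_def])
  then have "(\<lambda>n. \<omega> (\<sigma> n) (\<tau> n) z) \<longlonglongrightarrow> z"
    using no_jump [of c] c o z unfolding no_jump_at_def by auto
  then have "(\<lambda>n. \<omega> (\<tau> n) b (\<omega> (\<sigma> n) (\<tau> n) z) - \<omega> (\<tau> n) b z) \<longlonglongrightarrow> 0"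
    using o z by (intro self_maps_asymptotic_at_point self_map) auto
  then have "(\<lambda>n. \<omega> (\<sigma> n) b z - \<omega> (\<tau> n) b z) \<longlonglongrightarrow> 0"
    using o z by (simp add: compose)
  then have lim0: "(\<lambda>n. cmod (\<omega> (\<sigma> n) b z - \<omega> (\<tau> n) b z)) \<longlonglongrightarrow> 0"
    by (rule tendsto_norm_zero)
  have le: "cmod (\<omega> (u n) b z - \<omega> c b z) \<le> cmod (\<omega> (\<sigma> n) b z - \<omega> (\<tau> n) b z)" for n
    by (cases "u n \<le> c") (auto simp: \<sigma>_def \<tau>_def min_def max_def norm_minus_commute)
  have "(\<lambda>n. \<omega> (u n) b z - \<omega> c b z) \<longlonglongrightarrow> 0"
    by (rule Lim_null_comparison [OF always_eventually [OF allI [OF le]] lim0])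
  then show "(\<lambda>n. \<omega> (u n) b z) \<longlonglongrightarrow> \<omega> c b z" by (rule LIM_zero_cancel)
qed

text \<open>
  Let \<open>h\<close> be a subsequential limit of \<open>\<omega> (\<sigma> n) (\<tau> n)\<close> and \<open>g\<close> one of the terminal maps
  \<open>\<omega> (\<tau> n) b\<close>.  Then \<open>\<omega> (\<sigma> n) b\<close> tends to \<open>g \<circ> h\<close> along a subsequence, and \<open>g \<circ> h\<close> and \<open>g\<close>
  have the same derivative \<open>deriv (\<omega> c b) 0\<close> at \<open>0\<close>.  As it does not vanish, the chain rule yields
  \<open>deriv h 0 = 1\<close>, and the Schwarz lemma yields \<open>h z = z\<close>.  The maps \<open>\<omega> (\<tau> n) b\<close> are not known
  to converge to \<open>\<omega> c b\<close> at this stage, which is why \<open>g\<close> is extracted by compactness.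
\<close>

lemma no_jump_at_of_deriv:
  assumes c: "a \<le> c" "c \<le> b"
    and zero: "\<And>\<sigma> \<tau>. (\<And>n. a \<le> \<sigma> n \<and> \<sigma> n \<le> c \<and> c \<le> \<tau> n \<and> \<tau> n \<le> b) \<Longrightarrow> \<sigma> \<longlonglongrightarrow> c \<Longrightarrow> \<tau> \<longlonglongrightarrow> c \<Longrightarrow>
      (\<lambda>n. \<omega> (\<sigma> n) (\<tau> n) 0) \<longlonglongrightarrow> 0"
    and cont: "continuous_on {a..b} (\<lambda>s. deriv (\<omega> s b) 0)"
    and nz: "deriv (\<omega> c b) 0 \<noteq> 0"
  shows "no_jump_at c"
  unfolding no_jump_at_def
proof (intro allI impI)
  fix \<sigma> \<tau> :: "nat \<Rightarrow> real" and z :: complex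
  assume *: "(\<forall>n. a \<le> \<sigma> n \<and> \<sigma> n \<le> c \<and> c \<le> \<tau> n \<and> \<tau> n \<le> b) \<and> \<sigma> \<longlonglongrightarrow> c \<and> \<tau> \<longlonglongrightarrow> c" and z: "cmod z < 1"
  then have lims: "\<sigma> \<longlonglongrightarrow> c" "\<tau> \<longlonglongrightarrow> c" by auto
  have o: "a \<le> \<sigma> n" "\<sigma> n \<le> c" "c \<le> \<tau> n" "\<tau> n \<le> b" "\<sigma> n \<le> \<tau> n" "a \<le> \<tau> n" "\<sigma> n \<le> b" for n
    using * [THEN conjunct1, rule_format, of n] c by linarith+
  show "(\<lambda>n. \<omega> (\<sigma> n) (\<tau> n) z) \<longlonglongrightarrow> z"
  proof (rule self_maps_tendsto_by_subsequences [where F = "\<lambda>n. \<omega> (\<sigma> n) (\<tau> n)" and f = "\<lambda>z. z"])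
    show "\<omega> (\<sigma> n) (\<tau> n) \<in> \<BB>" and "cmod (\<omega> (\<sigma> n) (\<tau> n) 0) \<le> r" for n
      using o by (auto intro: self_map bound)
    show "r < 1" "cmod z < 1" by (fact r, fact z)
    fix k h z assume k: "strict_mono (k :: nat \<Rightarrow> nat)" and h: "h \<in> \<BB>"
      and lim: "\<And>z. cmod z < 1 \<Longrightarrow> (\<lambda>n. \<omega> (\<sigma> (k n)) (\<tau> (k n)) z) \<longlonglongrightarrow> h z"
      and z: "cmod z < 1"
    have "(\<lambda>n. \<omega> (\<sigma> (k n)) (\<tau> (k n)) 0) \<longlonglongrightarrow> 0"
      using LIMSEQ_subseq_LIMSEQ [OF zero [OF _ lims] k] o by (simp add: o_def)
    then have h0: "h 0 = 0" using lim [of 0] by (simp add: LIMSEQ_unique)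
    have maps: "\<omega> (\<tau> (k n)) b \<in> \<BB>" and bds: "cmod (\<omega> (\<tau> (k n)) b 0) \<le> r" for n
      using o by (auto intro: self_map bound)
    obtain l g where l: "strict_mono l" and g: "g \<in> \<BB>"
      and lim_g: "\<And>z. cmod z < 1 \<Longrightarrow> (\<lambda>n. \<omega> (\<tau> (k (l n))) b z) \<longlonglongrightarrow> g z"
      using self_maps_subsequential_limit [where F = "\<lambda>n. \<omega> (\<tau> (k n)) b", OF maps bds r] by blast
    define m where "m = k \<circ> l"
    have m: "strict_mono m" using k l by (simp add: m_def strict_mono_o)
    have gh: "g \<circ> h \<in> \<BB>"
      using g h unfolding mem_analytic_self_maps
      by (auto intro!: holomorphic_on_compose_gen [where t = \<D>])
    have lim_gh: "(\<lambda>n. \<omega> (\<sigma> (m n)) b x) \<longlonglongrightarrow> (g \<circ> h) x" if x: "cmod x < 1" for x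
    proof -
      have "(\<lambda>n. \<omega> (\<tau> (m n)) b (\<omega> (\<sigma> (m n)) (\<tau> (m n)) x)) \<longlonglongrightarrow> g (h x)"
      proof (rule self_maps_tendsto_compose [where q = "h x" and G = "\<lambda>n. \<omega> (\<tau> (m n)) b"])
        show "\<omega> (\<tau> (m n)) b \<in> \<BB>" for n using maps by (simp add: m_def)
        show "(\<lambda>n. \<omega> (\<sigma> (m n)) (\<tau> (m n)) x) \<longlonglongrightarrow> h x"
          using LIMSEQ_subseq_LIMSEQ [OF lim [OF x] l] by (simp add: m_def o_def)
        show "cmod (h x) < 1" using h x by (rule self_map_norm)
        then show "(\<lambda>n. \<omega> (\<tau> (m n)) b (h x)) \<longlonglongrightarrow> g (h x)" using lim_g by (simp add: m_def)
      qed
      then show ?thesis using o x by (simp add: compose)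
    qed
    have deriv_lim: "(\<lambda>n. deriv (\<omega> (\<upsilon> (m n)) b) 0) \<longlonglongrightarrow> deriv (\<omega> c b) 0"
      if "\<upsilon> \<longlonglongrightarrow> c" "\<And>n. a \<le> \<upsilon> n \<and> \<upsilon> n \<le> b" for \<upsilon>
      using that c LIMSEQ_subseq_LIMSEQ [OF that(1) m]
      by (intro continuous_on_tendsto_compose [OF cont]) (auto simp: o_def)
    have "(\<lambda>n. deriv (\<omega> (\<sigma> (m n)) b) 0) \<longlonglongrightarrow> deriv (g \<circ> h) 0"
      using o gh lim_gh by (intro self_maps_tendsto_deriv self_map) auto
    then have 1: "deriv (g \<circ> h) 0 = deriv (\<omega> c b) 0"
      using deriv_lim [OF lims(1)] o by (auto intro: LIMSEQ_unique)
    have "(\<lambda>n. deriv (\<omega> (\<tau> (m n)) b) 0) \<longlonglongrightarrow> deriv g 0"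
      using o g lim_g by (intro self_maps_tendsto_deriv self_map) (auto simp: m_def)
    then have 2: "deriv g 0 = deriv (\<omega> c b) 0"
      using deriv_lim [OF lims(2)] o by (auto intro: LIMSEQ_unique)
    have "g field_differentiable (at 0)" "h field_differentiable (at 0)"
      using g h by (auto intro: holomorphic_on_imp_differentiable_at [OF self_map_holomorphic])
    then have "deriv (g \<circ> h) 0 = deriv g 0 * deriv h 0"
      using h0 by (subst deriv_chain) auto
    then have "deriv h 0 = 1" using 1 2 nz by simp
    then show "h z = z" by (rule self_map_eq_identity [OF h h0 _ z])
  qed
qed

subsection \<open>Consequences of joint continuity\<close>

lemma jointly_continuous_tendsto:
  assumes "jointly_continuous {a..b} \<omega>" "cmod z < 1"
    and "\<And>n. a \<le> \<sigma> n \<and> \<sigma> n \<le> \<tau> n \<and> \<tau> n \<le> b" "a \<le> s" "s \<le> t" "t \<le> b"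
    and "\<sigma> \<longlonglongrightarrow> s" "\<tau> \<longlonglongrightarrow> t"
  shows "(\<lambda>n. \<omega> (\<sigma> n) (\<tau> n) z) \<longlonglongrightarrow> \<omega> s t z"
proof -
  have "(\<lambda>n. (case (\<sigma> n, \<tau> n) of (s, t) \<Rightarrow> \<omega> s t z)) \<longlonglongrightarrow> (case (s, t) of (s, t) \<Rightarrow> \<omega> s t z)"
  proof (rule continuous_on_tendsto_compose [where f = "\<lambda>(s, t). \<omega> s t z"])
    show "continuous_on (ordered_pairs {a..b}) (\<lambda>(s, t). \<omega> s t z)"
      using assms(1,2) by (simp add: jointly_continuous_iff)
    show "\<forall>\<^sub>F n in sequentially. (\<sigma> n, \<tau> n) \<in> ordered_pairs {a..b}" 
    proof (intro always_eventually allI)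
      show "(\<sigma> n, \<tau> n) \<in> ordered_pairs {a..b}" for n
        using assms(3) [of n] by (simp add: ordered_pairs_def)
    qed
  qed (use assms in \<open>auto simp: ordered_pairs_def intro: tendsto_Pair\<close>)
  then show ?thesis by simp
qed

lemma jointly_continuous_no_jump_at:
  assumes "jointly_continuous {a..b} \<omega>" "a \<le> c" "c \<le> b"
  shows "no_jump_at c"
  unfolding no_jump_at_def
proof (intro allI impI)
  fix \<sigma> \<tau> :: "nat \<Rightarrow> real" and z :: complex
  assume "(\<forall>n. a \<le> \<sigma> n \<and> \<sigma> n \<le> c \<and> c \<le> \<tau> n \<and> \<tau> n \<le> b) \<and> \<sigma> \<longlonglongrightarrow> c \<and> \<tau> \<longlonglongrightarrow> c" "cmod z < 1"
  then show "(\<lambda>n. \<omega> (\<sigma> n) (\<tau> n) z) \<longlonglongrightarrow> z"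
    using jointly_continuous_tendsto [OF assms(1), of z \<sigma> \<tau> c c] assms(2,3)
    by (auto simp: identity intro: order_trans [of _ c])
qed

lemma jointly_continuous_left_continuous:
  assumes "jointly_continuous {a..b} \<omega>"
  shows left_continuous
  unfolding left_continuous_def
  using assms by (intro allI impI continuous_on_sequentiallyI jointly_continuous_tendsto) auto

lemma jointly_continuous_deriv_continuous:
  assumes "jointly_continuous {a..b} \<omega>"
  shows "continuous_on {a..b} (\<lambda>s. deriv (\<omega> s b) 0)"
  using left_continuous_tendsto [OF jointly_continuous_left_continuous [OF assms]]
  by (intro continuous_on_sequentiallyI self_maps_tendsto_deriv self_map) auto

lemma jointly_continuous_deriv_nonzero:
  assumes "jointly_continuous {a..b} \<omega>" "a \<le> s" "s \<le> b"
  shows "deriv (\<omega> s b) 0 \<noteq> 0"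
proof (rule holomorphic_injective_imp_regular)
  show "\<omega> s b holomorphic_on \<D>"
    using assms(2,3) by (intro self_map_holomorphic self_map) auto
  show "inj_on (\<omega> s b) \<D>"
    using assms by (intro no_jumps_injective jointly_continuous_no_jump_at) auto
qed auto

end

section \<open>The equivalences\<close>

lemma tendsto_shrinking_to_iff:
  "(f \<longlongrightarrow> l) (shrinking_to a b c) \<longleftrightarrow>
    (\<forall>e>0. \<exists>d>0. \<forall>s t. a \<le> s \<and> s \<le> c \<and> c \<le> t \<and> t \<le> b \<and> s < t \<and> t - s < d \<longrightarrow> dist (f (s, t)) l < e)"
proof -
  have "(\<forall>\<^sub>F p in shrinking_to a b c. P p) \<longleftrightarrow>
      (\<exists>d>0. \<forall>s t. a \<le> s \<and> s \<le> c \<and> c \<le> t \<and> t \<le> b \<and> s < t \<and> t - s < d \<longrightarrow> P (s, t))" (is "_ \<longleftrightarrow> ?R") for P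
  proof
    assume "\<forall>\<^sub>F p in shrinking_to a b c. P p"
    then show ?R
      unfolding shrinking_to_def eventually_inf_principal eventually_filtercomap eventually_at_right_field
      by (force simp: algebra_simps)
  next
    assume ?R
    then obtain d where d: "0 < d" "\<And>s t. a \<le> s \<and> s \<le> c \<and> c \<le> t \<and> t \<le> b \<and> s < t \<and> t - s < d \<Longrightarrow> P (s, t)" by blast
    show "\<forall>\<^sub>F p in shrinking_to a b c. P p"
      unfolding shrinking_to_def eventually_inf_principal eventually_filtercomap eventually_at_right_field
      by (rule exI [of _ "\<lambda>x. 0 < x \<and> x < d"]) (use d in auto)
  qed
  then show ?thesis unfolding tendsto_iff by simp
qed

lemma hyperbolically_bounded_iff:
  assumes "a \<le> b" and ev: "evolution_family {a..b} \<omega>"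
  shows "hyperbolically_bounded {a..b} \<omega> \<longleftrightarrow> (\<exists>r. bounded_evolution a b \<omega> r)"
proof
  have bdd: "bdd_above ((\<lambda>(s, t). cmod (\<omega> s t 0)) ` ordered_pairs {a..b})"
  proof (rule bdd_aboveI2, clarify)
    fix s t assume "(s, t) \<in> ordered_pairs {a..b}"
    then have "\<omega> s t \<in> \<BB>"
      by (intro evolution_family_self_map [OF ev]) (simp_all add: ordered_pairs_def)
    then show "cmod (\<omega> s t 0) \<le> 1" using self_map_norm [of "\<omega> s t" 0] by simp
  qed
  assume "hyperbolically_bounded {a..b} \<omega>"
  then show "\<exists>r. bounded_evolution a b \<omega> r"
    unfolding hyperbolically_bounded_def
    using ev cSUP_upper [OF _ bdd]
    by (intro exI bounded_evolution.intro) (auto simp: ordered_pairs_def)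
next
  assume "\<exists>r. bounded_evolution a b \<omega> r"
  then obtain r where "bounded_evolution a b \<omega> r" ..
  then interpret bounded_evolution a b \<omega> r .
  have "(a, a) \<in> ordered_pairs {a..b}" using \<open>a \<le> b\<close> by (simp add: ordered_pairs_def)
  then have "(SUP (s, t)\<in>ordered_pairs {a..b}. cmod (\<omega> s t 0)) \<le> r"
    using bound by (intro cSUP_least) (auto simp: ordered_pairs_def)
  then show "hyperbolically_bounded {a..b} \<omega>" using r by (simp add: hyperbolically_bounded_def)
qed

text \<open>
  The continuous function \<open>|\<omega> s t 0|\<close> attains its maximum, a value less than \<open>1\<close>, on the compact
  triangle of ordered pairs.
\<close>

lemma jointly_continuous_bounded_evolution:
  assumes "a \<le> b" and ev: "evolution_family {a..b} \<omega>" and "jointly_continuous {a..b} \<omega>"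
  shows "\<exists>r. bounded_evolution a b \<omega> r"
proof -
  have maps: "\<omega> (fst p) (snd p) \<in> \<BB>" if "p \<in> ordered_pairs {a..b}" for p
    using that by (auto simp: ordered_pairs_def intro: evolution_family_self_map [OF ev])
  have cont: "continuous_on (ordered_pairs {a..b}) (\<lambda>p. \<omega> (fst p) (snd p) 0)"
    using \<open>jointly_continuous {a..b} \<omega>\<close> maps
      continuous_map_locally_uniform_iff [of "ordered_pairs {a..b}" "\<lambda>p. \<omega> (fst p) (snd p)"]
    by (simp add: jointly_continuous_def case_prod_unfold)
  have "ordered_pairs {a..b} = ({a..b} \<times> {a..b}) \<inter> {p. fst p \<le> snd p}"
    by (auto simp: ordered_pairs_def)
  moreover have "closed {p :: real \<times> real. fst p \<le> snd p}"
    by (intro closed_Collect_le continuous_intros)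
  ultimately have "compact (ordered_pairs {a..b})"
    by (simp add: compact_Int_closed compact_Times)
  moreover have "ordered_pairs {a..b} \<noteq> {}" using \<open>a \<le> b\<close> by (auto simp: ordered_pairs_def)
  ultimately obtain p where p: "p \<in> ordered_pairs {a..b}"
    "\<And>q. q \<in> ordered_pairs {a..b} \<Longrightarrow> cmod (\<omega> (fst q) (snd q) 0) \<le> cmod (\<omega> (fst p) (snd p) 0)"
    using continuous_attains_sup [OF _ _ continuous_on_norm [OF cont]] by blast
  have "bounded_evolution a b \<omega> (cmod (\<omega> (fst p) (snd p) 0))"
  proof
    show "cmod (\<omega> (fst p) (snd p) 0) < 1" using maps [OF p(1)] by (rule self_map_norm) simp
    show "cmod (\<omega> s t 0) \<le> cmod (\<omega> (fst p) (snd p) 0)" if "a \<le> s" "s \<le> t" "t \<le> b" for s t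
      using p(2) [of "(s, t)"] that by (simp add: ordered_pairs_def)
  qed fact
  then show ?thesis ..
qed

theorem theorem1p8:
  fixes a b :: real and \<omega> :: "real \<Rightarrow> real \<Rightarrow> complex \<Rightarrow> complex"
  assumes "a < b"
    and "evolution_family {a..b} \<omega>"
  shows "(jointly_continuous {a..b} \<omega> \<longleftrightarrow>
           hyperbolically_bounded {a..b} \<omega> \<and> continuous_in_left_parameter a b \<omega>) \<and>
         (jointly_continuous {a..b} \<omega> \<longleftrightarrow>
           hyperbolically_bounded {a..b} \<omega> \<and>
           (\<forall>c\<in>{a..b}. ((\<lambda>(s, t). \<omega> s t 0) \<longlongrightarrow> 0) (shrinking_to a b c)) \<and>
           continuous_on {a..b} (\<lambda>s. deriv (\<omega> s b) 0) \<and>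
           (\<forall>s\<in>{a..b}. deriv (\<omega> s b) 0 \<noteq> 0))"
    (is "(?J \<longleftrightarrow> ?H \<and> ?L) \<and> (?J \<longleftrightarrow> ?H \<and> ?Z \<and> ?D \<and> ?N)")
proof -
  have ab: "a \<le> b" using \<open>a < b\<close> by simp
  note H_iff = hyperbolically_bounded_iff [OF ab assms(2)]
  have J_imp: "?H \<and> ?L \<and> ?Z \<and> ?D \<and> ?N" if J: ?J
  proof -
    obtain r where ev: "bounded_evolution a b \<omega> r"
      using jointly_continuous_bounded_evolution [OF ab assms(2) J] ..
    then interpret bounded_evolution a b \<omega> r .
    have ?H using ev H_iff by blast
    moreover have ?L
      unfolding continuous_in_left_parameter_iff using J by (rule jointly_continuous_left_continuous)
    moreover have ?D using J by (rule jointly_continuous_deriv_continuous)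
    moreover have ?N using jointly_continuous_deriv_nonzero [OF J] by simp
    moreover have ?Z
      unfolding tendsto_shrinking_to_iff
    proof (intro ballI allI impI)
      fix c e :: real assume c: "c \<in> {a..b}" and "0 < e"
      have "continuous_on (ordered_pairs {a..b}) (\<lambda>(s, t). \<omega> s t 0)"
        using J by (simp add: jointly_continuous_iff)
      moreover have "(c, c) \<in> ordered_pairs {a..b}" using c by (simp add: ordered_pairs_def)
      ultimately obtain d where d: "0 < d" "\<And>p. p \<in> ordered_pairs {a..b} \<Longrightarrow> dist p (c, c) < d \<Longrightarrow>
          dist (case p of (s, t) \<Rightarrow> \<omega> s t 0) (\<omega> c c 0) < e"
        using \<open>0 < e\<close> unfolding continuous_on_iff by fastforce
      have "dist (\<omega> s t 0) 0 < e" if st: "a \<le> s" "s \<le> c" "c \<le> t" "t \<le> b" "t - s < d / 2" for s t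
      proof -
        have "dist (s, t) (c, c) \<le> dist s c + dist t c"
          unfolding dist_Pair_Pair by (rule sqrt_sum_squares_le_sum) auto
        also have "\<dots> < d" using st by (simp add: dist_real_def)
        finally show ?thesis using d(2) [of "(s, t)"] st c by (simp add: ordered_pairs_def identity)
      qed
      then show "\<exists>d>0. \<forall>s t. a \<le> s \<and> s \<le> c \<and> c \<le> t \<and> t \<le> b \<and> s < t \<and> t - s < d \<longrightarrow>
          dist (case (s, t) of (s, t) \<Rightarrow> \<omega> s t 0) 0 < e"
        using d(1) by (intro exI [of _ "d / 2"]) auto
    qed
    ultimately show ?thesis by blast
  qed
  have L_imp: ?J if H: ?H and L: ?L
  proof -
    obtain r where "bounded_evolution a b \<omega> r" using H H_iff by blast
    then interpret bounded_evolution a b \<omega> r .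
    show ?J using L continuous_in_left_parameter_iff by (intro jointly_continuous_of_left_continuous) simp
  qed
  have D_imp: ?J if H: ?H and Z: ?Z and D: ?D and N: ?N
  proof -
    obtain r where "bounded_evolution a b \<omega> r" using H H_iff by blast
    then interpret bounded_evolution a b \<omega> r .
    have "no_jump_at c" if c: "a \<le> c" "c \<le> b" for c
    proof (rule no_jump_at_of_deriv [OF c _ D])
      show "deriv (\<omega> c b) 0 \<noteq> 0" using N c by simp
      fix \<sigma> \<tau> :: "nat \<Rightarrow> real"
      assume o: "\<And>n. a \<le> \<sigma> n \<and> \<sigma> n \<le> c \<and> c \<le> \<tau> n \<and> \<tau> n \<le> b" and lims: "\<sigma> \<longlonglongrightarrow> c" "\<tau> \<longlonglongrightarrow> c"
      show "(\<lambda>n. \<omega> (\<sigma> n) (\<tau> n) 0) \<longlonglongrightarrow> 0"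
      proof (rule tendstoI)
        fix e :: real assume "0 < e"
        have "((\<lambda>(s, t). \<omega> s t 0) \<longlongrightarrow> 0) (shrinking_to a b c)"
          using Z c by simp
        then obtain d where d: "0 < d"
          "\<And>s t. a \<le> s \<and> s \<le> c \<and> c \<le> t \<and> t \<le> b \<and> s < t \<and> t - s < d \<Longrightarrow> dist (\<omega> s t 0) 0 < e"
          unfolding tendsto_shrinking_to_iff prod.case using \<open>0 < e\<close> by blast
        have "(\<lambda>n. \<tau> n - \<sigma> n) \<longlonglongrightarrow> 0" using tendsto_diff [OF lims(2,1)] by simp
        then have "\<forall>\<^sub>F n in sequentially. \<tau> n - \<sigma> n < d" using d(1) by (rule order_tendstoD)
        then show "\<forall>\<^sub>F n in sequentially. dist (\<omega> (\<sigma> n) (\<tau> n) 0) 0 < e"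
        proof eventually_elim
          case (elim n)
          \<comment> \<open>\<open>shrinking_to\<close> approaches \<open>t - s = 0\<close> from the right only; equal parameters give the identity.\<close>
          show ?case
          proof (cases "\<sigma> n = \<tau> n")
            case True
            then show ?thesis using o [of n] \<open>0 < e\<close> by (simp add: identity)
          next
            case False
            then show ?thesis using o [of n] elim by (intro d(2)) auto
          qed
        qed
      qed
    qed
    then show ?J by (intro jointly_continuous_of_left_continuous no_jumps_left_continuous)
  qed
  show ?thesis using J_imp L_imp D_imp by blast
qed

end
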